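(* The parameter $\mathbf{cmms}$ is closed under contractions: if $G_1$ and $G_2$ are connected graphs and $G_1$ is a contraction of $G_2$, then $\mathbf{cmms}(G_1)\le \mathbf{cmms}(G_2)$.
   Context: All graphs are finite, without loops or multiple edges. A graph $H$ is a contraction of $G$ if there is a surjection $\phi:V(G)\to V(H)$ such that $G[\phi^{-1}(v)]$ is connected for every $v\in V(H)$ and, for all distinct $u,v\in V(H)$, $\{u,v\}\in E(H)$ if and only if $G[\phi^{-1}(u)\cup\phi^{-1}(v)]$ is connected. A (mixed) search strategy on $G$ is a finite sequence $\mathcal{S}$ of moves, starting with no searchers on the graph, each of one of the types: placing a new searcher on a vertex $v$; deleting a searcher from a vertex $v$; sliding a searcher from $v$ along an edge $\{v,u\}$ and placing it on $u$. Set $E(\mathcal{S},0)=\emptyset$. For $i>0$, let $E^{(i)}$ be the set of edges cleaned by the $i$-th move, i.e. edges both of whose endpoints become occupied by searchers, and the edge along which a searcher slides in that move. Let $Q_i=E(\mathcal{S},i-1)\cup E^{(i)}$. Then $E(\mathcal{S},i)$ (the set of clean edges after $i$ moves) is $Q_i$ minus those edges $e$ for which there is a path starting from $e$ and finishing in an edge not in $Q_i$ such that no two consecutive edges of it meet at a vertex occupied by a searcher after the $i$-th move. The $i$-th move is a recontamination move if $E(\mathcal{S},i)\subsetneq Q_i$. The strategy is complete if $E(\mathcal{S},i)=E(G)$ for some $i$, monotone if it has no recontamination moves, and connected if for every $i$ the subgraph of $G$ formed by the edges in $E(\mathcal{S},i)$ and their endpoints is connected (the empty graph counts as connected). The number of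 searchers used by $\mathcal{S}$ is the maximum number of searchers on the graph during any move. For a connected graph $G$, $\mathbf{cmms}(G)$ is the minimum number of searchers used by a complete connected monotone search strategy on $G$ (it is $0$ if $G$ has no edges). *)

theory Defs
  imports Main "HOL-Library.Multiset"
begin

section \<open>Finite simple graphs and contractions\<close>

record 'a ugraph =
  verts :: "'a set"
  edges :: "'a set set"

definition simple_graph :: "'a ugraph \<Rightarrow> bool" where
  "simple_graph G \<longleftrightarrow> finite (verts G) \<and>
     (\<forall>e\<in>edges G. \<exists>u\<in>verts G. \<exists>v\<in>verts G. u \<noteq> v \<and> e = {u, v})"

definition graph_path :: "'a ugraph \<Rightarrow> 'a list \<Rightarrow> bool" where
  "graph_path G p \<longleftrightarrow> p \<noteq> [] \<and> distinct p \<and> set p \<subseteq> verts G \<and>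
     (\<forall>j. Suc j < length p \<longrightarrow> {p ! j, p ! Suc j} \<in> edges G)"

text \<open>The graph without vertices counts as connected.\<close>

definition connected_graph :: "'a ugraph \<Rightarrow> bool" where
  "connected_graph G \<longleftrightarrow>
     (\<forall>u\<in>verts G. \<forall>v\<in>verts G. \<exists>p. graph_path G p \<and> hd p = u \<and> last p = v)"

definition induced_subgraph :: "'a ugraph \<Rightarrow> 'a set \<Rightarrow> 'a ugraph" where
  "induced_subgraph G X = \<lparr>verts = verts G \<inter> X, edges = {e \<in> edges G. e \<subseteq> X}\<rparr>"

definition edge_subgraph :: "'a set set \<Rightarrow> 'a ugraph" where
  "edge_subgraph F = \<lparr>verts = \<Union>F, edges = F\<rparr>"

definition is_contraction_of :: "'b ugraph \<Rightarrow> 'a ugraph \<Rightarrow> bool" where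
  "is_contraction_of H G \<longleftrightarrow> (\<exists>\<phi>. \<phi> ` verts G = verts H \<and>
     (\<forall>v\<in>verts H. connected_graph (induced_subgraph G {x \<in> verts G. \<phi> x = v})) \<and>
     (\<forall>u\<in>verts H. \<forall>v\<in>verts H. u \<noteq> v \<longrightarrow>
        ({u, v} \<in> edges H \<longleftrightarrow>
         connected_graph (induced_subgraph G
           ({x \<in> verts G. \<phi> x = u} \<union> {x \<in> verts G. \<phi> x = v})))))"


section \<open>Mixed search strategies\<close>

datatype 'a move = Place 'a | Delete 'a | Slide 'a 'a

text \<open>A configuration is the multiset of the positions of the searchers, so several
  searchers may share a vertex.\<close>

fun legal_move :: "'a ugraph \<Rightarrow> 'a multiset \<Rightarrow> 'a move \<Rightarrow> bool" where
  "legal_move G P (Place v) \<longleftrightarrow> v \<in> verts G"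
| "legal_move G P (Delete v) \<longleftrightarrow> v \<in># P"
| "legal_move G P (Slide v u) \<longleftrightarrow> v \<in># P \<and> {v, u} \<in> edges G"

fun do_move :: "'a move \<Rightarrow> 'a multiset \<Rightarrow> 'a multiset" where
  "do_move (Place v) P = add_mset v P"
| "do_move (Delete v) P = P - {#v#}"
| "do_move (Slide v u) P = add_mset u (P - {#v#})"

fun slid_edges :: "'a move \<Rightarrow> 'a set set" where
  "slid_edges (Place v) = {}"
| "slid_edges (Delete v) = {}"
| "slid_edges (Slide v u) = {{v, u}}"

definition searchers_after :: "'a move list \<Rightarrow> nat \<Rightarrow> 'a multiset" where
  "searchers_after S i = fold do_move (take i S) {#}"

definition search_strategy :: "'a ugraph \<Rightarrow> 'a move list \<Rightarrow> bool" where
  "search_strategy G S \<longleftrightarrow> (\<forall>i<length S. legal_move G (searchers_after S i) (S ! i))"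

text \<open>List indices start at 0, so the move \<open>S ! i\<close> leads from the situation after \<open>i\<close> moves
  to the one after \<open>Suc i\<close> moves.  An edge whose endpoints were both occupied already before
  the move is clean anyway, so it does no harm to count it among the edges cleaned.\<close>

definition cleaned_by_move :: "'a ugraph \<Rightarrow> 'a move list \<Rightarrow> nat \<Rightarrow> 'a set set" where
  "cleaned_by_move G S i =
     {e \<in> edges G. e \<subseteq> set_mset (searchers_after S (Suc i))} \<union> slid_edges (S ! i)"

definition exposed :: "'a ugraph \<Rightarrow> 'a set \<Rightarrow> 'a set set \<Rightarrow> 'a set \<Rightarrow> bool" where
  "exposed G X Q e \<longleftrightarrow> (\<exists>p. graph_path G p \<and> 2 \<le> length p \<and>
     {p ! 0, p ! 1} = e \<and>
     {p ! (length p - 2), p ! (length p - 1)} \<notin> Q \<and>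
     (\<forall>j. 0 < j \<and> Suc j < length p \<longrightarrow> p ! j \<notin> X))"

primrec clean_edges :: "'a ugraph \<Rightarrow> 'a move list \<Rightarrow> nat \<Rightarrow> 'a set set" where
  "clean_edges G S 0 = {}"
| "clean_edges G S (Suc i) =
     (let Q = clean_edges G S i \<union> cleaned_by_move G S i
      in {e \<in> Q. \<not> exposed G (set_mset (searchers_after S (Suc i))) Q e})"

definition recontamination_move :: "'a ugraph \<Rightarrow> 'a move list \<Rightarrow> nat \<Rightarrow> bool" where
  "recontamination_move G S i \<longleftrightarrow>
     clean_edges G S (Suc i) \<subset> clean_edges G S i \<union> cleaned_by_move G S i"

definition complete_strategy :: "'a ugraph \<Rightarrow> 'a move list \<Rightarrow> bool" where
  "complete_strategy G S \<longleftrightarrow> (\<exists>i\<le>length S. clean_edges G S i = edges G)"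

definition monotone_strategy :: "'a ugraph \<Rightarrow> 'a move list \<Rightarrow> bool" where
  "monotone_strategy G S \<longleftrightarrow> (\<forall>i<length S. \<not> recontamination_move G S i)"

definition connected_strategy :: "'a ugraph \<Rightarrow> 'a move list \<Rightarrow> bool" where
  "connected_strategy G S \<longleftrightarrow>
     (\<forall>i\<le>length S. connected_graph (edge_subgraph (clean_edges G S i)))"

definition searchers_used :: "'a move list \<Rightarrow> nat" where
  "searchers_used S = Max ((\<lambda>i. size (searchers_after S i)) ` {..length S})"

definition cmms :: "'a ugraph \<Rightarrow> nat" where
  "cmms G = (LEAST k. \<exists>S. search_strategy G S \<and> complete_strategy G S \<and>
     connected_strategy G S \<and> monotone_strategy G S \<and> searchers_used S = k)"

text \<open>The empty strategy realises the convention for graphs without edges.\<close>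

lemma cmms_no_edges: "edges G = {} \<Longrightarrow> cmms G = 0"
  unfolding cmms_def
  by (rule Least_eq_0, rule exI[of _ "[]"])
     (simp add: search_strategy_def complete_strategy_def connected_strategy_def
       monotone_strategy_def searchers_used_def searchers_after_def
       connected_graph_def edge_subgraph_def)

end

theory Submission
  imports Defs
begin

text \<open>
Let \<open>\<phi>\<close> contract \<open>G\<close> to \<open>H\<close>. Replaying a search of \<open>G\<close> in \<open>H\<close> move by move, with every
searcher moved to its image, fails: two searchers on non-adjacent vertices of \<open>G\<close> may have
adjacent images, so that the replay cleans an edge of \<open>H\<close> too early, far away from the
territory cleaned so far or with nobody left to protect it. Instead, only the territory is
projected. If \<open>F\<close> is the set of clean edges in \<open>G\<close>, the search of \<open>H\<close> aims at the vertex set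
\<open>W = \<phi> ` \<Union>F\<close>, cleans exactly the edges that lie within \<open>W\<close>, and keeps one searcher on each vertex
of the border of \<open>W\<close>, the vertices of \<open>W\<close> with a neighbour outside \<open>W\<close>. Such a state is
called swept.

The set \<open>W\<close> is connected because \<open>F\<close> is. Its border is covered by the images of the searchers:
in a fibre without searchers monotonicity carries cleanness from edge to edge, and since fibres
are connected, either all edges that meet the fibre are clean or none is
(\<open>fibre_homogeneous\<close>, \<open>border_image_subset\<close>). So every set \<open>W\<close> can be held with as many
searchers as are present in \<open>G\<close>; what remains is the passage from \<open>W\<close> to the next set \<open>W'\<close>.

If, before or after the move, the images of the searchers cover the border of \<open>W\<close> and all of
\<open>W' - W\<close>, then the new vertices are occupied one at a time, in an order that keeps the swept set
connected (\<open>swept_grow\<close>). The only move for which this can fail is a slide that leaves the fibre of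
a vertex \<open>a\<close> without searchers. Then all edges at \<open>a\<close> are clean after the move, and the searcher
on \<open>a\<close> is given up by a slide in \<open>H\<close>, after all other neighbours of \<open>a\<close> have been swept
(\<open>swept_slide_grow\<close>). If \<open>a\<close> cannot be swept before the slide for lack of a neighbour in \<open>W\<close>, then
\<open>a\<close> is a leaf of \<open>H\<close>, and the searcher can wait on \<open>a\<close> and then slide into the territory
(\<open>swept_leaf\<close>).

The same growing procedure, with a searcher for every vertex, shows that a connected graph has a
strategy at all, so that the minimum defining \<open>cmms\<close> is attained.
\<close>

section \<open>Connectivity by reachability\<close>

definition adj :: "'a set set \<Rightarrow> ('a \<times> 'a) set" where
  "adj F = {(x, y). {x, y} \<in> F}"

lemma adj_iff [simp]: "(x, y) \<in> adj F \<longleftrightarrow> {x, y} \<in> F"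
  by (simp add: adj_def)

lemma adj_mono: "F \<subseteq> F' \<Longrightarrow> (adj F)\<^sup>* \<subseteq> (adj F')\<^sup>*"
  by (rule rtrancl_mono) (auto simp: adj_def)

lemma adj_rtrancl_sym: "(x, y) \<in> (adj F)\<^sup>* \<Longrightarrow> (y, x) \<in> (adj F)\<^sup>*"
proof -
  have "sym (adj F)" by (auto simp: sym_def insert_commute)
  then show "(x, y) \<in> (adj F)\<^sup>* \<Longrightarrow> (y, x) \<in> (adj F)\<^sup>*"
    by (meson sym_rtrancl symD)
qed

lemma graph_path_successively:
  "graph_path G p \<longleftrightarrow> p \<noteq> [] \<and> distinct p \<and> set p \<subseteq> verts G \<and>
     successively (\<lambda>x y. {x, y} \<in> edges G) p"
  by (auto simp: graph_path_def successively_conv_nth)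

lemma rtrancl_imp_path:
  assumes "(u, v) \<in> (adj (edges G))\<^sup>*" and "u \<in> verts G" and "\<forall>e\<in>edges G. e \<subseteq> verts G"
  shows "\<exists>p. graph_path G p \<and> hd p = u \<and> last p = v"
  using assms(1)
proof (induction rule: rtrancl_induct)
  case base
  show ?case
    by (rule exI[of _ "[u]"]) (simp add: graph_path_def assms(2))
next
  case (step y z)
  then obtain p where p: "graph_path G p" "hd p = u" "last p = y" by blast
  show ?case
  proof (cases "z \<in> set p")
    case True
    \<comment> \<open>Paths have no repeated vertices, so a walk that returns to \<open>z\<close> is cut off there.\<close>
    then obtain xs ys where pq: "p = xs @ z # ys" by (meson split_list)
    have "graph_path G (xs @ [z])"
      using p(1) unfolding graph_path_successively pq
      by (auto simp: successively_append_iff)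
    moreover have "hd (xs @ [z]) = u" using p(2) pq by (cases xs) auto
    ultimately show ?thesis by (intro exI[of _ "xs @ [z]"]) simp
  next
    case False
    have "graph_path G (p @ [z])"
      using p step(2) assms(3) False unfolding graph_path_successively
      by (auto simp: successively_append_iff)
    moreover have "hd (p @ [z]) = u"
      using p unfolding graph_path_def by simp
    ultimately show ?thesis by (intro exI[of _ "p @ [z]"]) simp
  qed
qed

lemma path_imp_rtrancl:
  "successively (\<lambda>x y. {x, y} \<in> F) p \<Longrightarrow> p \<noteq> [] \<Longrightarrow> (hd p, last p) \<in> (adj F)\<^sup>*"
proof (induction p)
  case (Cons x p)
  show ?case
  proof (cases p)
    case (Cons y q)
    then have "(x, y) \<in> adj F" "(y, last p) \<in> (adj F)\<^sup>*"
      using Cons.IH Cons.prems by auto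
    then show ?thesis using Cons by (auto intro: converse_rtrancl_into_rtrancl)
  qed simp
qed simp

lemma connected_graph_iff:
  assumes "\<forall>e\<in>edges G. e \<subseteq> verts G"
  shows "connected_graph G \<longleftrightarrow>
    (\<forall>u\<in>verts G. \<forall>v\<in>verts G. (u, v) \<in> (adj (edges G))\<^sup>*)"
proof -
  have "(\<exists>p. graph_path G p \<and> hd p = u \<and> last p = v) \<longleftrightarrow> (u, v) \<in> (adj (edges G))\<^sup>*"
    if "u \<in> verts G" for u v
    using rtrancl_imp_path[OF _ that assms] path_imp_rtrancl[of "edges G"]
    by (auto simp: graph_path_successively)
  then show ?thesis by (simp add: connected_graph_def)
qed

definition within :: "'a ugraph \<Rightarrow> 'a set \<Rightarrow> 'a set set" where
  "within G W = {e \<in> edges G. e \<subseteq> W}"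

definition conn :: "'a ugraph \<Rightarrow> 'a set \<Rightarrow> bool" where
  "conn G W \<longleftrightarrow> (\<forall>x\<in>W. \<forall>y\<in>W. (x, y) \<in> (adj (within G W))\<^sup>*)"

lemma connected_edge_subgraph_iff:
  "connected_graph (edge_subgraph F) \<longleftrightarrow> (\<forall>x\<in>\<Union>F. \<forall>y\<in>\<Union>F. (x, y) \<in> (adj F)\<^sup>*)"
  by (subst connected_graph_iff) (auto simp: edge_subgraph_def)

lemma connected_induced_iff:
  assumes "simple_graph G" "X \<subseteq> verts G"
  shows "connected_graph (induced_subgraph G X) \<longleftrightarrow> conn G X"
proof -
  have "verts G \<inter> X = X" using assms by auto
  then show ?thesis
    by (subst connected_graph_iff) (auto simp: induced_subgraph_def conn_def within_def)
qed

lemma conn_connected_within: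
  "conn G W \<Longrightarrow> connected_graph (edge_subgraph (within G W))"
  unfolding connected_edge_subgraph_iff conn_def by (auto simp: within_def)

lemma within_mono: "W \<subseteq> W' \<Longrightarrow> within G W \<subseteq> within G W'"
  by (auto simp: within_def)

lemma conn_Un:
  assumes "conn G A" "conn G B" "x \<in> A" "y \<in> B" "{x, y} \<in> edges G"
  shows "conn G (A \<union> B)"
proof -
  let ?R = "(adj (within G (A \<union> B)))\<^sup>*"
  have A: "(u, v) \<in> ?R" if "u \<in> A" "v \<in> A" for u v
    using assms(1) that adj_mono[OF within_mono[of A "A \<union> B" G]] by (auto simp: conn_def)
  have B: "(u, v) \<in> ?R" if "u \<in> B" "v \<in> B" for u v
    using assms(2) that adj_mono[OF within_mono[of B "A \<union> B" G]] by (auto simp: conn_def)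
  have xy: "(x, y) \<in> ?R"
    using assms by (intro r_into_rtrancl) (auto simp: within_def)
  have AB: "(u, v) \<in> ?R" if "u \<in> A" "v \<in> B" for u v
    using A[OF that(1) assms(3)] xy B[OF assms(4) that(2)] by (meson rtrancl_trans)
  have BA: "(v, u) \<in> ?R" if "u \<in> A" "v \<in> B" for u v
    using adj_rtrancl_sym[OF AB[OF that]] .
  show ?thesis
    unfolding conn_def using A B AB BA by blast
qed

lemma conn_singleton: "conn G {c}"
  by (simp add: conn_def)

lemma conn_insert:
  assumes "conn G W" "x \<in> W" "{x, c} \<in> edges G"
  shows "conn G (insert c W)"
  using conn_Un[OF assms(1) conn_singleton[of G c] assms(2) _ assms(3)] by simp

lemma conn_Un_neighbours:
  assumes "finite N" "conn G W" "x \<in> W" "\<forall>c\<in>N. {x, c} \<in> edges G"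
  shows "conn G (W \<union> N)"
  using assms(1,4)
proof (induction N)
  case empty
  then show ?case using assms by simp
next
  case (insert c N)
  then show ?case using conn_insert[of G "W \<union> N" x c] assms(3) by simp
qed

lemma rtrancl_crossing:
  assumes "(u, v) \<in> R\<^sup>*" "u \<in> A" "v \<notin> A"
  shows "\<exists>x y. (x, y) \<in> R \<and> x \<in> A \<and> y \<notin> A"
proof -
  have "v \<in> A" if "\<forall>x y. (x, y) \<in> R \<longrightarrow> x \<in> A \<longrightarrow> y \<in> A"
    using assms(1,2) by (induction rule: rtrancl_induct) (use that in blast)+
  then show ?thesis using assms(3) by blast
qed

lemma conn_crossing:
  assumes "conn G W'" "u \<in> W" "u \<in> W'" "v \<in> W'" "v \<notin> W"
  shows "\<exists>x y. {x, y} \<in> edges G \<and> x \<in> W \<and> x \<in> W' \<and> y \<in> W' \<and> y \<notin> W"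
proof -
  have "(u, v) \<in> (adj (within G W'))\<^sup>*" using assms by (auto simp: conn_def)
  from rtrancl_crossing[OF this assms(2,5)] show ?thesis
    by (auto simp: within_def)
qed

lemma simple_graph_edgeE:
  assumes "simple_graph G" "e \<in> edges G"
  obtains x y where "e = {x, y}" "x \<noteq> y" "x \<in> verts G" "y \<in> verts G"
  using assms unfolding simple_graph_def by blast

lemma simple_graph_edge_at:
  assumes "simple_graph G" "e \<in> edges G" "x \<in> e"
  obtains y where "e = {x, y}" "x \<noteq> y" "x \<in> verts G" "y \<in> verts G"
  using assms by (elim simple_graph_edgeE) (auto simp: insert_commute)

lemma within_empty: "simple_graph G \<Longrightarrow> within G {} = {}"
  by (auto simp: within_def elim: simple_graph_edgeE)

section \<open>Monotone connected search as a transition system\<close>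

text \<open>That no edge of \<open>F\<close> is recontaminated is a local condition: every vertex between a clean
and a dirty edge is occupied. It replaces the quantification over exposing paths.\<close>

definition guarded :: "'a ugraph \<Rightarrow> 'a set \<Rightarrow> 'a set set \<Rightarrow> bool" where
  "guarded G X F \<longleftrightarrow>
     (\<forall>x e f. x \<notin> X \<longrightarrow> e \<in> F \<longrightarrow> x \<in> e \<longrightarrow> f \<in> edges G \<longrightarrow> x \<in> f \<longrightarrow> f \<in> F)"

lemma guardedD:
  "guarded G X F \<Longrightarrow> x \<notin> X \<Longrightarrow> e \<in> F \<Longrightarrow> x \<in> e \<Longrightarrow> f \<in> edges G \<Longrightarrow> x \<in> f \<Longrightarrow> f \<in> F"
  by (auto simp: guarded_def)

text \<open>An unguarded vertex gives an exposing path with two edges; conversely cleanness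
spreads along a path through unoccupied vertices, one edge after the other, up to its last edge.\<close>

lemma no_exposed_iff_guarded:
  assumes "simple_graph G" "F \<subseteq> edges G"
  shows "(\<forall>e\<in>F. \<not> exposed G X F e) \<longleftrightarrow> guarded G X F"
proof
  assume L: "\<forall>e\<in>F. \<not> exposed G X F e"
  show "guarded G X F"
    unfolding guarded_def
  proof (intro allI impI, rule ccontr)
    fix x e f
    assume H: "x \<notin> X" "e \<in> F" "x \<in> e" "f \<in> edges G" "x \<in> f" "f \<notin> F"
    obtain y where y: "e = {x, y}" "x \<noteq> y" "x \<in> verts G" "y \<in> verts G"
      using simple_graph_edge_at[OF assms(1) _ H(3)] H(2) assms(2) by blast
    obtain z where z: "f = {x, z}" "x \<noteq> z" "z \<in> verts G"
      using simple_graph_edge_at[OF assms(1) H(4,5)] by blast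
    have "y \<noteq> z" using H y z by auto
    have "{y, x} \<in> edges G" using y H assms(2) by (auto simp: insert_commute)
    then have "graph_path G [y, x, z]"
      using y z \<open>y \<noteq> z\<close> H by (auto simp: graph_path_successively)
    then have "exposed G X F e"
      unfolding exposed_def using y z H
      by (intro exI[of _ "[y, x, z]"]) (auto simp: insert_commute less_Suc_eq)
    then show False using L H by blast
  qed
next
  assume R: "guarded G X F"
  show "\<forall>e\<in>F. \<not> exposed G X F e"
  proof (intro ballI notI)
    fix e assume e: "e \<in> F" and "exposed G X F e"
    then obtain p where p: "graph_path G p" "2 \<le> length p" "{p ! 0, p ! 1} = e"
      "{p ! (length p - 2), p ! (length p - 1)} \<notin> F"
      "\<And>j. 0 < j \<Longrightarrow> Suc j < length p \<Longrightarrow> p ! j \<notin> X"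
      unfolding exposed_def by blast
    have "Suc j < length p \<Longrightarrow> {p ! j, p ! Suc j} \<in> F" for j
    proof (induction j)
      case 0
      then show ?case using p e by simp
    next
      case (Suc j)
      then have "{p ! j, p ! Suc j} \<in> F" by simp
      moreover have "p ! Suc j \<notin> X" using p(5)[of "Suc j"] Suc.prems by simp
      moreover have "{p ! Suc j, p ! Suc (Suc j)} \<in> edges G"
        using p(1) Suc.prems unfolding graph_path_def by blast
      ultimately show ?case using R by (auto intro: guardedD)
    qed
    from this[of "length p - 2"] p(2,4) show False
      by (metis Suc_1 Suc_diff_Suc diff_less lessI less_le_trans One_nat_def zero_less_Suc Suc_le_lessD)
  qed
qed

text \<open>The pairs of searcher positions and clean edges that occur in connected monotone
strategies with at most \<open>k\<close> searchers. For monotone strategies a pair determines how the search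
can go on, so strategies can be extended and simulated by induction, without reference to
sequences of moves.\<close>

inductive searched :: "'a ugraph \<Rightarrow> nat \<Rightarrow> 'a multiset \<Rightarrow> 'a set set \<Rightarrow> bool" for G k where
  start: "searched G k {#} {}"
| move: "searched G k P F \<Longrightarrow> legal_move G P m \<Longrightarrow> P' = do_move m P \<Longrightarrow> size P' \<le> k \<Longrightarrow>
    F' = F \<union> (within G (set_mset P') \<union> slid_edges m) \<Longrightarrow> guarded G (set_mset P') F' \<Longrightarrow>
    connected_graph (edge_subgraph F') \<Longrightarrow> searched G k P' F'"

lemma slid_edges_legal: "legal_move G P m \<Longrightarrow> slid_edges m \<subseteq> edges G"
  by (cases m) auto

lemma searched_subset: "searched G k P F \<Longrightarrow> F \<subseteq> edges G"
  by (induction rule: searched.induct) (auto simp: within_def dest: slid_edges_legal)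

lemma searchers_after_Suc:
  "i < length S \<Longrightarrow> searchers_after S (Suc i) = do_move (S ! i) (searchers_after S i)"
  by (simp add: searchers_after_def take_Suc_conv_app_nth)

lemma searchers_used_le_iff:
  "searchers_used S \<le> k \<longleftrightarrow> (\<forall>i\<le>length S. size (searchers_after S i) \<le> k)"
  by (auto simp: searchers_used_def)

lemma strategy_imp_searched:
  assumes "simple_graph G" "search_strategy G S" "monotone_strategy G S" "connected_strategy G S"
    "searchers_used S \<le> k" "i \<le> length S"
  shows "searched G k (searchers_after S i) (clean_edges G S i)"
  using assms(6)
proof (induction i)
  case 0
  then show ?case by (simp add: searchers_after_def start)
next
  case (Suc i)
  let ?P = "searchers_after S (Suc i)"
  let ?Q = "clean_edges G S i \<union> cleaned_by_move G S i"
  have IH: "searched G k (searchers_after S i) (clean_edges G S i)" using Suc by simp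
  have legal: "legal_move G (searchers_after S i) (S ! i)"
    using assms(2) Suc.prems by (simp add: search_strategy_def)
  have sub: "?Q \<subseteq> edges G"
    using searched_subset[OF IH] slid_edges_legal[OF legal] by (auto simp: cleaned_by_move_def)
  have "\<not> recontamination_move G S i"
    using assms(3) Suc.prems by (simp add: monotone_strategy_def)
  then have eq: "clean_edges G S (Suc i) = ?Q"
    unfolding recontamination_move_def by (auto simp: Let_def)
  then have "\<forall>e\<in>?Q. \<not> exposed G (set_mset ?P) ?Q e"
    by (auto simp: Let_def)
  then have g: "guarded G (set_mset ?P) ?Q"
    using no_exposed_iff_guarded[OF assms(1) sub] by blast
  show ?case
    unfolding eq
  proof (rule searched.move[OF IH legal _ _ _ g])
    show "?P = do_move (S ! i) (searchers_after S i)"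
      using Suc.prems by (simp add: searchers_after_Suc)
    show "size ?P \<le> k" using assms(5) Suc.prems unfolding searchers_used_le_iff by blast
    show "connected_graph (edge_subgraph ?Q)"
      using assms(4) Suc.prems unfolding eq[symmetric] connected_strategy_def by blast
  qed (simp add: cleaned_by_move_def within_def)
qed

lemma searchers_after_append:
  "i \<le> length S \<Longrightarrow> searchers_after (S @ T) i = searchers_after S i"
  by (simp add: searchers_after_def)

lemma clean_edges_append:
  "i \<le> length S \<Longrightarrow> clean_edges G (S @ T) i = clean_edges G S i"
proof (induction i)
  case (Suc i)
  then have "cleaned_by_move G (S @ T) i = cleaned_by_move G S i"
    by (simp add: cleaned_by_move_def searchers_after_append nth_append)
  then show ?case using Suc by (simp add: searchers_after_append Let_def)
qed simp

lemma recontamination_append: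
  "i < length S \<Longrightarrow> recontamination_move G (S @ T) i \<longleftrightarrow> recontamination_move G S i"
  by (simp add: recontamination_move_def clean_edges_append cleaned_by_move_def
      searchers_after_append nth_append Let_def del: clean_edges.simps)

lemma searched_imp_strategy:
  assumes "simple_graph G" "searched G k P F"
  shows "\<exists>S. search_strategy G S \<and> monotone_strategy G S \<and> connected_strategy G S \<and>
    searchers_used S \<le> k \<and> searchers_after S (length S) = P \<and> clean_edges G S (length S) = F"
  using assms(2)
proof (induction rule: searched.induct)
  case start
  show ?case
    by (rule exI[of _ "[]"])
       (simp add: search_strategy_def connected_strategy_def monotone_strategy_def
         searchers_used_def searchers_after_def connected_graph_def edge_subgraph_def)
next
  case (move P F m P' F')
  then obtain S where S: "search_strategy G S" "monotone_strategy G S" "connected_strategy G S"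
    "searchers_used S \<le> k" "searchers_after S (length S) = P" "clean_edges G S (length S) = F"
    by blast
  let ?T = "S @ [m]" and ?n = "length S"
  have P': "searchers_after ?T (Suc ?n) = P'"
    using S(5) move by (simp add: searchers_after_Suc searchers_after_append)
  have Q: "clean_edges G ?T ?n \<union> cleaned_by_move G ?T ?n = F'"
    using S(6) move P' by (simp add: clean_edges_append cleaned_by_move_def within_def)
  have "F' \<subseteq> edges G"
    using searched_subset[OF searched.move[OF move(1-7)]] .
  then have "\<forall>e\<in>F'. \<not> exposed G (set_mset P') F' e"
    using no_exposed_iff_guarded[OF assms(1)] move by blast
  then have F': "clean_edges G ?T (Suc ?n) = F'"
    by (auto simp: Q P' Let_def)
  have "search_strategy G ?T"
    using S move(2) unfolding search_strategy_def
    by (auto simp: less_Suc_eq searchers_after_append nth_append)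
  moreover have "monotone_strategy G ?T"
    unfolding monotone_strategy_def
  proof (intro allI impI)
    fix i assume "i < length ?T"
    then consider "i < ?n" | "i = ?n" by fastforce
    then show "\<not> recontamination_move G ?T i"
    proof cases
      case 1
      then show ?thesis using S(2) by (simp add: recontamination_append monotone_strategy_def)
    next
      case 2
      show ?thesis unfolding 2 recontamination_move_def Q F' by simp
    qed
  qed
  moreover have "connected_strategy G ?T"
    unfolding connected_strategy_def
  proof (intro allI impI)
    fix i assume "i \<le> length ?T"
    then consider "i \<le> ?n" | "i = Suc ?n" by fastforce
    then show "connected_graph (edge_subgraph (clean_edges G ?T i))"
    proof cases
      case 1
      then show ?thesis using S(3) by (simp add: clean_edges_append connected_strategy_def)
    next
      case 2
      show ?thesis unfolding 2 F' by (rule move)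
    qed
  qed
  moreover have "searchers_used ?T \<le> k"
    unfolding searchers_used_le_iff
  proof (intro allI impI)
    fix i assume "i \<le> length ?T"
    then consider "i \<le> ?n" | "i = Suc ?n" by fastforce
    then show "size (searchers_after ?T i) \<le> k"
    proof cases
      case 1
      then show ?thesis using S(4) unfolding searchers_used_le_iff
        by (simp add: searchers_after_append)
    next
      case 2
      show ?thesis unfolding 2 P' by (rule move)
    qed
  qed
  ultimately show ?case using P' F' by (intro exI[of _ ?T]) simp
qed

lemma searched_imp_cmms_le:
  assumes "simple_graph G" "searched G k P (edges G)"
  shows "cmms G \<le> k"
proof -
  obtain S where S: "search_strategy G S" "monotone_strategy G S" "connected_strategy G S"
    "searchers_used S \<le> k" "clean_edges G S (length S) = edges G"
    using searched_imp_strategy[OF assms] by blast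
  then have "complete_strategy G S" by (auto simp: complete_strategy_def)
  then have "cmms G \<le> searchers_used S"
    unfolding cmms_def using S by (intro Least_le) blast
  then show ?thesis using S by simp
qed

text \<open>The hypothesis provides some strategy for \<open>G\<close>, without which the least number of
searchers would not be attained by any.\<close>

lemma searched_cmms:
  assumes "simple_graph G" "searched G k P (edges G)"
  shows "\<exists>P. searched G (cmms G) P (edges G)"
proof -
  let ?good = "\<lambda>k S. search_strategy G S \<and> complete_strategy G S \<and>
     connected_strategy G S \<and> monotone_strategy G S \<and> searchers_used S = k"
  obtain S where "search_strategy G S" "monotone_strategy G S" "connected_strategy G S"
    "clean_edges G S (length S) = edges G"
    using searched_imp_strategy[OF assms] by blast
  then have "\<exists>k S. ?good k S" by (auto simp: complete_strategy_def)
  then have "\<exists>S. ?good (cmms G) S"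
    unfolding cmms_def by (rule LeastI_ex)
  then obtain S where S: "?good (cmms G) S" by blast
  then obtain i where "i \<le> length S" "clean_edges G S i = edges G"
    by (auto simp: complete_strategy_def)
  then show ?thesis
    using strategy_imp_searched[OF assms(1), of S "cmms G" i] S by fastforce
qed

section \<open>Searching a growing vertex set\<close>

definition border :: "'a ugraph \<Rightarrow> 'a set \<Rightarrow> 'a set" where
  "border G W = {x \<in> W. \<exists>y. y \<notin> W \<and> {x, y} \<in> edges G}"

text \<open>All states used in the contracted graph have this form. A placement on a vertex \<open>c\<close>
outside \<open>W\<close> then cleans exactly the edges between \<open>c\<close> and \<open>W\<close>, because the neighbours of \<open>c\<close> in \<open>W\<close>
are on the border and hence occupied; so the form is restored by
deleting the searchers behind the new border.\<close>

definition swept :: "'a ugraph \<Rightarrow> nat \<Rightarrow> 'a set \<Rightarrow> bool" where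
  "swept G k W \<longleftrightarrow> W \<subseteq> verts G \<and> conn G W \<and>
     searched G k (mset_set (border G W)) (within G W)"

lemma borderD: "x \<in> W \<Longrightarrow> x \<notin> border G W \<Longrightarrow> {x, y} \<in> edges G \<Longrightarrow> y \<in> W"
  by (auto simp: border_def)

lemma border_subset: "border G W \<subseteq> W"
  by (auto simp: border_def)

lemma border_Un: "border G (W \<union> D) \<subseteq> border G W \<union> D"
  by (auto simp: border_def)

lemma guarded_within:
  assumes "simple_graph G" "border G W \<subseteq> X"
  shows "guarded G X (within G W)"
  unfolding guarded_def
proof (intro allI impI)
  fix x e f
  assume H: "x \<notin> X" "e \<in> within G W" "x \<in> e" "f \<in> edges G" "x \<in> f"
  obtain y where "f = {x, y}" using simple_graph_edge_at[OF assms(1) H(4,5)] by blast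
  moreover have "x \<in> W" using H by (auto simp: within_def)
  ultimately show "f \<in> within G W"
    using H assms(2) borderD[of x W G y] by (auto simp: within_def)
qed

lemma swept_empty:
  assumes "simple_graph G"
  shows "swept G k {}"
  using within_empty[OF assms] by (auto simp: swept_def conn_def border_def intro: searched.start)

text \<open>Searchers on vertices of \<open>W\<close> that are not on the border can be deleted one by one,
since such vertices belong to no dirty edge.\<close>

lemma swept_if_searched:
  assumes G: "simple_graph G" "conn G W" "W \<subseteq> verts G"
    and "finite X" "border G W \<subseteq> X" "X \<subseteq> W" "searched G k (mset_set X) (within G W)"
    "card X \<le> k"
  shows "swept G k W"
  using assms(4-)
proof (induction "card (X - border G W)" arbitrary: X)
  case 0
  then have "X = border G W" by auto
  then show ?case using 0 G by (simp add: swept_def)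
next
  case (Suc n)
  then obtain x where x: "x \<in> X" "x \<notin> border G W"
    by (metis Diff_iff card.empty ex_in_conv nat.distinct(1))
  let ?X = "X - {x}"
  have P: "mset_set ?X = mset_set X - {#x#}"
    using x Suc.prems by (simp add: mset_set_Diff)
  have set: "set_mset (mset_set ?X) = ?X" using Suc.prems by simp
  have "searched G k (mset_set ?X) (within G W)"
  proof (rule searched.move[OF Suc.prems(4), of "Delete x"])
    show "size (mset_set ?X) \<le> k" using Suc.prems x by simp
    show "within G W = within G W \<union> (within G (set_mset (mset_set ?X)) \<union> slid_edges (Delete x))"
      unfolding set using within_mono[of ?X W G] Suc.prems by auto
    show "guarded G (set_mset (mset_set ?X)) (within G W)"
      unfolding set using Suc.prems x by (intro guarded_within G) auto
    show "connected_graph (edge_subgraph (within G W))"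
      by (rule conn_connected_within[OF G(2)])
  qed (use x Suc.prems P in auto)
  moreover have "X - border G W = insert x (?X - border G W)" using x by auto
  then have "n = card (?X - border G W)" using Suc.hyps(2) Suc.prems by simp
  moreover have "card ?X \<le> k" using Suc.prems by (meson card_Diff1_le le_trans)
  ultimately show ?case using Suc.hyps(1)[of ?X] Suc.prems x by blast
qed

lemma swept_finite:
  assumes "simple_graph G" "swept G k W"
  shows "finite W" "finite (border G W)"
  using assms finite_subset[OF border_subset] finite_subset
  by (auto simp: swept_def simple_graph_def)

lemma within_insert:
  assumes "simple_graph G" "c \<notin> W"
  shows "within G (insert c W) = within G W \<union> {{c, y} | y. y \<in> border G W \<and> {c, y} \<in> edges G}"
proof (intro equalityI subsetI)
  fix e assume e: "e \<in> within G (insert c W)"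
  show "e \<in> within G W \<union> {{c, y} | y. y \<in> border G W \<and> {c, y} \<in> edges G}"
  proof (cases "c \<in> e")
    case True
    then obtain y where "e = {c, y}" "c \<noteq> y"
      using simple_graph_edge_at[OF assms(1)] e by (metis (no_types, lifting) mem_Collect_eq within_def)
    moreover from this have "y \<in> border G W"
      using e assms(2) by (auto simp: within_def border_def insert_commute)
    ultimately show ?thesis using e by (auto simp: within_def)
  next
    case False
    then show ?thesis using e by (auto simp: within_def)
  qed
next
  fix e assume "e \<in> within G W \<union> {{c, y} | y. y \<in> border G W \<and> {c, y} \<in> edges G}"
  then show "e \<in> within G (insert c W)" by (auto simp: within_def border_def)
qed

lemma swept_insert:
  assumes G: "simple_graph G" and sw: "swept G k W"
    and c: "c \<in> verts G" "c \<notin> W" "conn G (insert c W)" "card (insert c (border G W)) \<le> k"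
  shows "swept G k (insert c W)"
proof -
  note fin = swept_finite[OF G sw]
  let ?X = "insert c (border G W)"
  have cb: "c \<notin> border G W" using c border_subset[of G W] by blast
  have b: "border G (insert c W) \<subseteq> ?X" using border_Un[of G W "{c}"] by auto
  have set: "set_mset (mset_set ?X) = ?X" using fin by simp
  have "searched G k (mset_set ?X) (within G (insert c W))"
  proof (rule searched.move[of _ _ "mset_set (border G W)" "within G W" "Place c"])
    show "within G (insert c W) =
        within G W \<union> (within G (set_mset (mset_set ?X)) \<union> slid_edges (Place c))"
      unfolding set using within_insert[OF G c(2)] within_mono[of ?X "insert c W" G] border_subset[of G W]
      by (auto simp: within_def)
    show "guarded G (set_mset (mset_set ?X)) (within G (insert c W))"
      unfolding set by (rule guarded_within[OF G b])
  qed (use sw c fin cb in \<open>auto simp: swept_def conn_connected_within\<close>)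
  then show ?thesis
    using swept_if_searched[OF G c(3) _ _ b] c sw fin border_subset[of G W]
    by (auto simp: swept_def)
qed

text \<open>The searcher on \<open>a\<close> can leave because \<open>b\<close> is the last neighbour of \<open>a\<close> outside \<open>W\<close>.
In contrast to placing a searcher on \<open>b\<close>, this never needs an additional searcher.\<close>

lemma swept_slide:
  assumes G: "simple_graph G" and sw: "swept G k W"
    and ab: "a \<in> W" "b \<notin> W" "{a, b} \<in> edges G" "\<forall>y. {a, y} \<in> edges G \<longrightarrow> y \<in> insert b W"
    and k: "card (border G W) \<le> k"
  shows "swept G k (insert b W)"
proof -
  note fin = swept_finite[OF G sw]
  have a: "a \<in> border G W" using ab by (auto simp: border_def)
  let ?X = "insert b (border G W - {a})"
  have bb: "b \<notin> border G W" using ab border_subset[of G W] by blast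
  have cn: "conn G (insert b W)" using conn_insert sw ab by (auto simp: swept_def)
  have bv: "b \<in> verts G" using simple_graph_edge_at[OF G ab(3), of b] by auto
  have b: "border G (insert b W) \<subseteq> ?X" using ab by (auto simp: border_def)
  have set: "set_mset (mset_set ?X) = ?X" using fin by simp
  have P: "mset_set ?X = do_move (Slide a b) (mset_set (border G W))"
    using fin a bb by (simp add: mset_set_Diff)
  have "card ?X = Suc (card (border G W - {a}))" using fin bb by (intro card_insert_disjoint) auto
  then have card: "card ?X \<le> k" using k card.remove[OF fin(2) a] by linarith
  have "searched G k (mset_set ?X) (within G (insert b W))"
  proof (rule searched.move[OF _ _ P])
    show "within G (insert b W) =
        within G W \<union> (within G (set_mset (mset_set ?X)) \<union> slid_edges (Slide a b))"
      unfolding set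
    proof (intro equalityI Un_least)
      show "within G (insert b W) \<subseteq> within G W \<union> (within G ?X \<union> slid_edges (Slide a b))"
        unfolding within_insert[OF G ab(2)] by (auto simp: within_def insert_commute)
      show "within G ?X \<subseteq> within G (insert b W)"
        using border_subset[of G W] by (intro within_mono) auto
      show "within G W \<subseteq> within G (insert b W)" by (intro within_mono) auto
      show "slid_edges (Slide a b) \<subseteq> within G (insert b W)" using ab by (auto simp: within_def)
    qed
    show "guarded G (set_mset (mset_set ?X)) (within G (insert b W))"
      unfolding set by (rule guarded_within[OF G b])
  qed (use sw ab a fin cn card in \<open>auto simp: swept_def conn_connected_within\<close>)
  then show ?thesis
    using swept_if_searched[OF G cn _ _ b] bv sw fin border_subset[of G W] card
    by (auto simp: swept_def)
qed

text \<open>A searcher is placed on the leaf \<open>a\<close> outside \<open>W\<close>. This cleans nothing, so the clean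
edges stay connected although \<open>a\<close> is away from \<open>W\<close>. Its slide to \<open>b\<close> then sweeps \<open>a\<close> and \<open>b\<close>
together. Sweeping \<open>b\<close> first would require searchers on both \<open>a\<close> and \<open>b\<close> next to those on the
border.\<close>

lemma swept_leaf:
  assumes G: "simple_graph G" and sw: "swept G k W"
    and ab: "a \<notin> W" "b \<notin> W" "{a, b} \<in> edges G" "\<forall>y. {a, y} \<in> edges G \<longrightarrow> y = b"
    and w: "w \<in> W" "{w, b} \<in> edges G"
    and k: "card (border G W) < k"
  shows "swept G k (insert a (insert b W))"
proof -
  note fin = swept_finite[OF G sw]
  let ?W = "insert a (insert b W)" and ?X = "insert b (border G W)"
  have v: "a \<in> verts G" "b \<in> verts G" "a \<noteq> b"
    using simple_graph_edgeE[OF G ab(3)] by (metis doubleton_eq_iff)+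
  have nb: "a \<notin> border G W" "b \<notin> border G W" "a \<noteq> b"
    using ab(1,2) border_subset[of G W] v(3) by auto
  have cn0: "conn G (insert b W)" using conn_insert sw w by (auto simp: swept_def)
  then have cn: "conn G ?W" using conn_insert[OF cn0, of b a] ab(3) by (simp add: insert_commute)
  have b: "border G ?W \<subseteq> ?X" unfolding border_def using ab(4) by blast
  have set: "set_mset (mset_set ?X) = ?X" "set_mset (mset_set (insert a (border G W))) = insert a (border G W)"
    using fin by simp_all
  have within_a: "within G (insert a W) \<subseteq> within G W"
    unfolding within_insert[OF G ab(1)] using ab(4) nb(2) by blast
  then have within_a: "within G (insert a (border G W)) \<subseteq> within G W"
    using within_mono[of "insert a (border G W)" "insert a W" G] border_subset[of G W] by blast
  have A: "searched G k (mset_set (insert a (border G W))) (within G W)"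
  proof (rule searched.move[of _ _ "mset_set (border G W)" "within G W" "Place a"])
    show "within G W = within G W \<union> (within G (set_mset (mset_set (insert a (border G W)))) \<union> slid_edges (Place a))"
      unfolding set using within_a by auto
    show "guarded G (set_mset (mset_set (insert a (border G W)))) (within G W)"
      unfolding set by (rule guarded_within[OF G]) auto
  qed (use sw v fin nb k in \<open>auto simp: swept_def conn_connected_within\<close>)
  have P: "mset_set ?X = do_move (Slide a b) (mset_set (insert a (border G W)))"
    using fin nb by simp
  have eqW: "within G ?W = within G (insert b W) \<union> {{a, b}}"
  proof -
    have "a \<notin> insert b W" using ab(1) nb(3) by simp
    note eq = within_insert[OF G this]
    have "b \<in> border G (insert b W)"
      unfolding border_def using ab(3) \<open>a \<notin> insert b W\<close> by (auto simp: insert_commute)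
    then show ?thesis unfolding eq using ab(3,4) by blast
  qed
  have "searched G k (mset_set ?X) (within G ?W)"
  proof (rule searched.move[OF A _ P])
    show "within G ?W = within G W \<union> (within G (set_mset (mset_set ?X)) \<union> slid_edges (Slide a b))"
      unfolding set eqW
    proof (intro equalityI Un_least)
      show "within G (insert b W) \<subseteq> within G W \<union> (within G ?X \<union> slid_edges (Slide a b))"
        unfolding within_insert[OF G ab(2)] by (auto simp: within_def)
      show "within G ?X \<subseteq> within G (insert b W) \<union> {{a, b}}"
        using border_subset[of G W] by (intro le_supI1 within_mono) auto
      show "within G W \<subseteq> within G (insert b W) \<union> {{a, b}}"
        by (intro le_supI1 within_mono) auto
    qed simp_all
    show "guarded G (set_mset (mset_set ?X)) (within G ?W)"
      unfolding set by (rule guarded_within[OF G b])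
  qed (use ab(3) fin cn nb k in \<open>auto simp: conn_connected_within\<close>)
  moreover have "?W \<subseteq> verts G" using sw v by (auto simp: swept_def)
  moreover have "card ?X \<le> k" using fin nb k by simp
  ultimately show ?thesis
    using swept_if_searched[OF G cn _ _ b] fin border_subset[of G W] by blast
qed

text \<open>The set \<open>Y\<close> contains the border of every set between \<open>W\<close> and \<open>W'\<close>, so it bounds the
number of searchers throughout. Connectedness of \<open>W'\<close> provides the next vertex.\<close>

lemma swept_grow:
  assumes G: "simple_graph G" and "swept G k W"
    and W': "W' \<subseteq> verts G" "conn G W'"
    and "W \<subseteq> W'"
    and Y: "finite Y" "card Y \<le> k" "border G W \<subseteq> Y" "W' - W \<subseteq> Y"
  shows "swept G k W'"
  using assms(2,5) Y(3,4)
proof (induction "card (W' - W)" arbitrary: W)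
  case 0
  have "finite W'" using W' G by (auto simp: simple_graph_def intro: finite_subset)
  then have "W = W'" using 0 by auto
  then show ?case using 0 by simp
next
  case (Suc n)
  have "finite W'" using W' G by (auto simp: simple_graph_def intro: finite_subset)
  obtain d where d: "d \<in> W'" "d \<notin> W"
    by (metis Suc.hyps(2) Diff_iff card.empty ex_in_conv nat.distinct(1))
  obtain c where c: "c \<in> W'" "c \<notin> W" "conn G (insert c W)"
  proof (cases "W = {}")
    case True
    then show ?thesis using that[of d] d conn_singleton[of G d] by simp
  next
    case False
    then obtain u where "u \<in> W" by blast
    then obtain x y where "{x, y} \<in> edges G" "x \<in> W" "y \<in> W'" "y \<notin> W"
      using conn_crossing[OF W'(2), of u W d] d Suc.prems by blast
    then show ?thesis using that[of y] conn_insert[of G W x y] Suc.prems(1) by (auto simp: swept_def)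
  qed
  have "insert c (border G W) \<subseteq> Y" using Suc.prems c by auto
  then have "card (insert c (border G W)) \<le> k" using Y by (meson card_mono le_trans)
  then have sw: "swept G k (insert c W)"
    using swept_insert[OF G Suc.prems(1)] c W' by auto
  have eq: "W' - insert c W = W' - W - {c}" by auto
  have "card (W' - W) = Suc (card (W' - W - {c}))"
    using c \<open>finite W'\<close> by (intro card.remove) auto
  then have "n = card (W' - insert c W)"
    unfolding eq using Suc.hyps(2) by linarith
  then show ?case
    using Suc.hyps(1)[of "insert c W"] sw c Suc.prems border_Un[of G W "{c}"] by auto
qed

text \<open>This is the effect in \<open>H\<close> of a slide in \<open>G\<close> after which no searcher is left in the
fibre of \<open>a\<close>: before the move the searchers cover \<open>Y\<close>, after it they cover \<open>Y - {a}\<close> together with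
\<open>b\<close>. The union of the two sets may have one element too many, so the growth has to be split into a
part within \<open>Y\<close>, the exchange of \<open>a\<close> for \<open>b\<close>, and a part within the second set.\<close>

lemma swept_slide_grow:
  assumes G: "simple_graph G" and sw: "swept G k W"
    and W': "W' \<subseteq> verts G" "conn G W'" "W \<subseteq> W'"
    and Y: "finite Y" "card Y \<le> k" "border G W \<subseteq> Y" "W' - W \<subseteq> insert b Y"
    and Y': "card (insert b (Y - {a})) \<le> k"
    and ab: "a \<in> Y" "a \<in> W'" "b \<in> W'" "{a, b} \<in> edges G"
    and nbr: "\<forall>y. {a, y} \<in> edges G \<longrightarrow> y \<in> W'"
    and leaf: "a \<notin> W \<Longrightarrow> W \<noteq> {} \<Longrightarrow> \<forall>w\<in>W. {w, a} \<notin> edges G \<Longrightarrow>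
      (\<forall>y. {a, y} \<in> edges G \<longrightarrow> y = b) \<and> (\<exists>w\<in>W. {w, b} \<in> edges G)"
  shows "swept G k W'"
proof -
  let ?Y' = "insert b (Y - {a})"
  have finW': "finite W'" using W' G by (auto simp: simple_graph_def intro: finite_subset)
  have finish: "swept G k W'"
    if "swept G k V" "V \<subseteq> W'" "W \<subseteq> V" "a \<in> V" "border G V \<subseteq> ?Y'" for V
  proof (rule swept_grow[OF G that(1) W'(1,2) that(2) _ Y' that(5)])
    show "W' - V \<subseteq> ?Y'" using that(3,4) Y(4) by blast
  qed (use Y in simp)
  have cW: "conn G W" using sw by (simp add: swept_def)
  show ?thesis
  proof (cases "conn G (insert a W)")
    case True
    \<comment> \<open>Once \<open>V\<close> is swept, \<open>b\<close> is the only neighbour of \<open>a\<close> that can be missing.\<close>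
    define N where "N = {y. {a, y} \<in> edges G} - {b}"
    define V where "V = insert a W \<union> N"
    have NW': "N \<subseteq> W'" using nbr by (auto simp: N_def)
    then have "finite N" using finW' finite_subset by blast
    then have cV: "conn G V"
      unfolding V_def by (rule conn_Un_neighbours[OF _ True, of N a]) (simp_all add: N_def)
    have VW': "V \<subseteq> W'" using NW' ab(2) W'(3) by (auto simp: V_def)
    have "b \<notin> N" by (simp add: N_def)
    then have VY: "V - W \<subseteq> Y" using NW' Y(4) ab(1) by (auto simp: V_def)
    have WV: "W \<subseteq> V" "a \<in> V" by (auto simp: V_def)
    have sV: "swept G k V"
      using swept_grow[OF G sw subset_trans[OF VW' W'(1)] cV WV(1) Y(1-3) VY] .
    have "border G V \<subseteq> border G W \<union> (V - W)"
      using WV(1) by (auto simp: border_def)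
    then have bV: "border G V \<subseteq> Y" using Y(3) VY by blast
    have nV: "y \<in> insert b V" if "{a, y} \<in> edges G" for y
      using that by (auto simp: V_def N_def)
    show ?thesis
    proof (cases "b \<in> V")
      case True
      then have "a \<notin> border G V" using nV by (auto simp: border_def)
      then have "border G V \<subseteq> ?Y'" using bV by blast
      then show ?thesis using finish[OF sV VW' WV] by blast
    next
      case False
      have "card (border G V) \<le> k" using bV Y(1,2) by (meson card_mono le_trans)
      then have sV': "swept G k (insert b V)"
        using swept_slide[OF G sV WV(2) False ab(4)] nV by blast
      have "a \<notin> border G (insert b V)" using nV by (auto simp: border_def)
      moreover have "border G (insert b V) \<subseteq> insert b Y"
        using border_Un[of G V "{b}"] bV by auto
      ultimately have "border G (insert b V) \<subseteq> ?Y'" by blast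
      then show ?thesis using finish[OF sV'] VW' WV ab(3) by blast
    qed
  next
    case False
    have aW: "a \<notin> W" using False cW by (metis insert_absorb)
    have "W \<noteq> {}" using False conn_singleton[of G a] by auto
    have na: "\<forall>w\<in>W. {w, a} \<notin> edges G" using False conn_insert[OF cW] by blast
    obtain w where lf: "\<forall>y. {a, y} \<in> edges G \<longrightarrow> y = b" and w: "w \<in> W" "{w, b} \<in> edges G"
      using leaf[OF aW \<open>W \<noteq> {}\<close> na] by blast
    have bW: "b \<notin> W" using na ab(4) by (metis insert_commute)
    have b1: "border G W \<subseteq> Y - {a}" using Y(3) aW border_subset[of G W] by blast
    then have "border G W \<subset> Y" using ab(1) by blast
    then have "card (border G W) < card Y" by (rule psubset_card_mono[OF Y(1)])
    then have "card (border G W) < k" using Y(2) by linarith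
    then have sV: "swept G k (insert a (insert b W))"
      using swept_leaf[OF G sw aW bW ab(4) lf w] by blast
    have "border G (insert a (insert b W)) \<subseteq> insert b (border G W)"
      unfolding border_def using lf by blast
    then have "border G (insert a (insert b W)) \<subseteq> ?Y'" using b1 by blast
    then show ?thesis using finish[OF sV] ab(2,3) W'(3) by blast
  qed
qed

lemma within_verts: "simple_graph G \<Longrightarrow> within G (verts G) = edges G"
  by (auto simp: within_def elim: simple_graph_edgeE)

text \<open>With a searcher for every vertex the whole vertex set can be swept, starting from
the empty set.\<close>

lemma connected_graph_searched_cmms:
  assumes G: "simple_graph G" and "connected_graph G"
  shows "\<exists>P. searched G (cmms G) P (edges G)"
proof -
  have "conn G (verts G)"
    using assms connected_graph_iff[of G] within_verts[OF G]
    by (auto simp: conn_def elim: simple_graph_edgeE)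
  then have "swept G (card (verts G)) (verts G)"
    using swept_grow[OF G swept_empty[OF G], of "verts G" "verts G"] G
    by (auto simp: simple_graph_def border_def)
  then show ?thesis
    using searched_cmms[OF G] by (auto simp: swept_def within_verts[OF G])
qed

lemma card_set_mset_le_size: "card (set_mset M) \<le> size M"
  by (induction M) (auto simp: card_insert_if)

section \<open>Contractions\<close>

text \<open>For fibres that are connected themselves, connectedness of the union of two of them
means that an edge joins them. The assumptions \<open>edge_down\<close> and \<open>edge_up\<close> state the contraction in
this form.\<close>

locale contraction =
  fixes H :: "'b ugraph" and G :: "'a ugraph" and \<phi> :: "'a \<Rightarrow> 'b"
  assumes simple_H: "simple_graph H" and simple_G: "simple_graph G"
    and onto: "\<phi> ` verts G = verts H"
    and fibre_conn: "a \<in> verts H \<Longrightarrow> conn G {x \<in> verts G. \<phi> x = a}"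
    and edge_down: "{x, y} \<in> edges G \<Longrightarrow> \<phi> x \<noteq> \<phi> y \<Longrightarrow> {\<phi> x, \<phi> y} \<in> edges H"
    and edge_up: "{a, b} \<in> edges H \<Longrightarrow> \<exists>x y. {x, y} \<in> edges G \<and> \<phi> x = a \<and> \<phi> y = b"
begin

text \<open>Cleanness of an edge at \<open>x\<close> is carried along a walk inside the fibre to \<open>y\<close>, as no
vertex on the walk is occupied.\<close>

lemma fibre_homogeneous:
  assumes g: "guarded G X F" "F \<subseteq> edges G" and a: "a \<notin> \<phi> ` X"
    and e: "e \<in> F" "x \<in> e" "\<phi> x = a" and f: "f \<in> edges G" "y \<in> f" "\<phi> y = a"
  shows "f \<in> F"
proof -
  have "e \<in> edges G" using e g by blast
  then have xv: "x \<in> verts G" "y \<in> verts G"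
    using simple_graph_edge_at[OF simple_G _ e(2)] simple_graph_edge_at[OF simple_G f(1,2)]
    by blast+
  then have "a \<in> verts H" using e onto by auto
  then have "(x, y) \<in> (adj (within G {x \<in> verts G. \<phi> x = a}))\<^sup>*"
    using fibre_conn xv e f by (auto simp: conn_def)
  then have "\<exists>e'\<in>F. y \<in> e'"
  proof (induction rule: rtrancl_induct)
    case base
    then show ?case using e by blast
  next
    case (step y z)
    then obtain e' where "e' \<in> F" "y \<in> e'" by blast
    moreover have "{y, z} \<in> edges G" "\<phi> y = a" using step by (auto simp: within_def)
    ultimately have "{y, z} \<in> F" using a guardedD[OF g(1), of y e' "{y, z}"] by auto
    then show ?case by auto
  qed
  then show ?thesis using guardedD[OF g(1), of y _ f] a f by auto
qed

lemma image_all_neighbours: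
  assumes g: "guarded G X F" "F \<subseteq> edges G" and a: "a \<notin> \<phi> ` X" "a \<in> \<phi> ` \<Union>F"
    and "{a, c} \<in> edges H"
  shows "\<exists>x y. {x, y} \<in> F \<and> \<phi> x = a \<and> \<phi> y = c"
proof -
  obtain x y where "{x, y} \<in> edges G" "\<phi> x = a" "\<phi> y = c"
    using edge_up[OF assms(5)] by blast
  moreover obtain e z where "e \<in> F" "z \<in> e" "\<phi> z = a" using a(2) by blast
  ultimately have "{x, y} \<in> F" using fibre_homogeneous[OF g a(1), of e z "{x, y}" x] by blast
  then show ?thesis using \<open>\<phi> x = a\<close> \<open>\<phi> y = c\<close> by blast
qed

lemma border_image_subset:
  assumes "guarded G X F" "F \<subseteq> edges G"
  shows "border H (\<phi> ` \<Union>F) \<subseteq> \<phi> ` X"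
proof
  fix a assume "a \<in> border H (\<phi> ` \<Union>F)"
  then obtain c where c: "a \<in> \<phi> ` \<Union>F" "c \<notin> \<phi> ` \<Union>F" "{a, c} \<in> edges H"
    by (auto simp: border_def)
  show "a \<in> \<phi> ` X"
  proof (rule ccontr)
    assume "a \<notin> \<phi> ` X"
    from image_all_neighbours[OF assms this c(1,3)] c(2) show False by blast
  qed
qed

lemma conn_image:
  assumes "F \<subseteq> edges G" "connected_graph (edge_subgraph F)"
  shows "conn H (\<phi> ` \<Union>F)"
proof -
  have "(\<phi> x, \<phi> y) \<in> (adj (within H (\<phi> ` \<Union>F)))\<^sup>*" if "(x, y) \<in> (adj F)\<^sup>*" for x y
    using that
  proof (induction rule: rtrancl_induct)
    case (step y z)
    show ?case
    proof (cases "\<phi> y = \<phi> z")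
      case False
      then have "{\<phi> y, \<phi> z} \<in> within H (\<phi> ` \<Union>F)"
        using step(2) edge_down assms(1) by (auto simp: within_def)
      then show ?thesis using step(3) by (meson adj_iff rtrancl.rtrancl_into_rtrancl)
    qed (use step in simp)
  qed simp
  then show ?thesis using assms(2) unfolding conn_def connected_edge_subgraph_iff
    by (metis (no_types, lifting) imageE)
qed

lemma image_subset_verts:
  assumes "F \<subseteq> edges G"
  shows "\<phi> ` \<Union>F \<subseteq> verts H"
proof -
  have "\<Union>F \<subseteq> verts G" using assms by (blast elim: simple_graph_edge_at[OF simple_G])
  then show ?thesis using onto by blast
qed

text \<open>Besides the projected state, the induction keeps the properties of the state in \<open>G\<close>
that the next move relies on: monotonicity, the bound on the searchers, and that edges between
occupied vertices are clean.\<close>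

lemma swept_image:
  assumes "searched G k P F"
  shows "swept H k (\<phi> ` \<Union>F) \<and> guarded G (set_mset P) F \<and> size P \<le> k \<and>
    within G (set_mset P) \<subseteq> F"
  using assms
proof (induction rule: searched.induct)
  case start
  show ?case
    using swept_empty[OF simple_H] within_empty[OF simple_G] by (simp add: guarded_def)
next
  case (move P F m P' F')
  let ?W = "\<phi> ` \<Union>F" and ?W' = "\<phi> ` \<Union>F'"
  let ?Y = "\<phi> ` set_mset P" and ?Y' = "\<phi> ` set_mset P'"
  have IH: "swept H k ?W" "guarded G (set_mset P) F" "size P \<le> k" "within G (set_mset P) \<subseteq> F"
    using move.IH by auto
  have Fs: "F \<subseteq> edges G" using searched_subset[OF move(1)] .
  have F's: "F' \<subseteq> edges G" using searched_subset[OF searched.move[OF move(1-7)]] .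
  have card: "card (\<phi> ` set_mset R) \<le> k" if "size R \<le> k" for R
    using that card_image_le[of "set_mset R" \<phi>] card_set_mset_le_size[of R] by fastforce
  note cY = card[OF IH(3)] card[OF move(4)]
  have finY: "finite ?Y" "finite ?Y'" by simp_all
  note bW = border_image_subset[OF IH(2) Fs] and bW' = border_image_subset[OF move(6) F's]
  have W': "?W' \<subseteq> verts H" "conn H ?W'"
    using image_subset_verts[OF F's] conn_image[OF F's move(7)] by auto
  have mono: "?W \<subseteq> ?W'" using move(5) by auto
  have new: "?W' - ?W \<subseteq> ?Y' \<union> \<phi> ` \<Union>(slid_edges m)"
    using move(5) by (auto simp: within_def)
  have "swept H k ?W'"
  proof (cases "\<exists>v u. m = Slide v u \<and> \<phi> v \<notin> ?Y'")
    case False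
    \<comment> \<open>The larger of the two sets of searcher images covers the border and all new vertices.\<close>
    have "?Y \<subseteq> ?Y' \<and> ?W' - ?W \<subseteq> ?Y' \<or> ?Y' \<subseteq> ?Y \<and> ?W' - ?W \<subseteq> ?Y'"
    proof (cases m)
      case (Place v)
      then show ?thesis using new move(3) by auto
    next
      case (Delete v)
      then have "set_mset P' \<subseteq> set_mset P" using move(3) by (auto dest: in_diffD)
      then show ?thesis using new Delete by auto
    next
      case (Slide v u)
      have "x \<in># P' \<or> x = v" if "x \<in># P" for x
        using that move(3) Slide by (cases "x = v") (auto simp: in_diff_count)
      then have "?Y \<subseteq> ?Y'" using False Slide by auto
      moreover have "\<phi> u \<in> ?Y'" "\<phi> v \<in> ?Y'" using False Slide move(3) by auto
      then have "\<phi> ` \<Union>(slid_edges m) \<subseteq> ?Y'" using Slide by simp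
      then have "?W' - ?W \<subseteq> ?Y'" using new by (meson Un_least order_refl subset_trans)
      ultimately show ?thesis by blast
    qed
    then show ?thesis
    proof (elim disjE conjE)
      assume Y: "?Y \<subseteq> ?Y'" "?W' - ?W \<subseteq> ?Y'"
      show ?thesis
        by (rule swept_grow[OF simple_H IH(1) W' mono finY(2) cY(2) subset_trans[OF bW Y(1)] Y(2)])
    next
      assume Y: "?Y' \<subseteq> ?Y" "?W' - ?W \<subseteq> ?Y'"
      show ?thesis
        by (rule swept_grow[OF simple_H IH(1) W' mono finY(1) cY(1) bW subset_trans[OF Y(2,1)]])
    qed
  next
    case True
    then obtain v u where m: "m = Slide v u" and vY': "\<phi> v \<notin> ?Y'" by blast
    define a b where "a = \<phi> v" and "b = \<phi> u"
    have vP: "v \<in># P" and uv: "{v, u} \<in> edges G" using move(2) m by auto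
    have P': "P' = add_mset u (P - {#v#})" using move(3) m by simp
    have aY: "a \<in> ?Y" and aY': "a \<notin> ?Y'" and bY': "b \<in> ?Y'"
      using vP vY' P' a_def b_def by auto
    then have "a \<noteq> b" by auto
    have YY': "?Y' = insert b (?Y - {a})"
    proof -
      have "x \<in># P'" if "x \<in># P" "\<phi> x \<noteq> a" for x
        using that P' a_def by (cases "x = v") (auto simp: in_diff_count)
      moreover have "x \<in># P \<or> x = u" if "x \<in># P'" for x
        using that P' by (auto dest: in_diffD)
      ultimately show ?thesis using aY' bY' b_def by fastforce
    qed
    have ab: "{a, b} \<in> edges H" using edge_down[OF uv] \<open>a \<noteq> b\<close> by (simp add: a_def b_def)
    have uvF': "{v, u} \<in> F'" using move(5) m by simp
    then have aW': "a \<in> ?W'" and bW'': "b \<in> ?W'" by (auto simp: a_def b_def)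
    have nbr: "\<exists>x y. {x, y} \<in> F' \<and> \<phi> x = a \<and> \<phi> y = c" if "{a, c} \<in> edges H" for c
      using image_all_neighbours[OF move(6) F's aY' aW' that] .
    have newY: "?W' - ?W \<subseteq> insert b ?Y"
    proof
      fix c assume "c \<in> ?W' - ?W"
      then have "c \<in> ?Y' \<union> \<phi> ` \<Union>(slid_edges m)" using new by (rule rev_subsetD)
      then show "c \<in> insert b ?Y" unfolding YY' using m aY by (auto simp: a_def b_def)
    qed
    show ?thesis
    proof (rule swept_slide_grow[OF simple_H IH(1) W' mono finY(1) cY(1) bW newY _ aY aW' bW'' ab])
      show "card (insert b (?Y - {a})) \<le> k" using cY(2) by (simp only: YY')
      show "\<forall>c. {a, c} \<in> edges H \<longrightarrow> c \<in> ?W'" using nbr by blast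
      assume aW: "a \<notin> ?W" and "?W \<noteq> {}" and na: "\<forall>w\<in>?W. {w, a} \<notin> edges H"
      \<comment> \<open>No clean edge met the fibre of \<open>a\<close> before the move, and both endpoints of an edge cleaned by
        occupation are outside this fibre. So the edge of the slide is the only one that leaves
        the fibre.\<close>
      have "c = b" if c: "{a, c} \<in> edges H" for c
      proof -
        obtain x y where xy: "{x, y} \<in> F'" "\<phi> x = a" "\<phi> y = c" using nbr[OF c] by blast
        have "{x, y} \<notin> F" using aW xy by blast
        moreover have "{x, y} \<notin> within G (set_mset P')" using aY' xy by (auto simp: within_def)
        ultimately have "{x, y} = {v, u}" using xy(1) move(5) m by simp
        moreover have "a \<noteq> c" using simple_graph_edgeE[OF simple_H c] by (metis doubleton_eq_iff)
        ultimately show ?thesis using xy a_def b_def \<open>a \<noteq> b\<close> by (auto simp: doubleton_eq_iff)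
      qed
      moreover have "\<exists>w\<in>?W. {w, b} \<in> edges H"
      proof -
        \<comment> \<open>The new clean edges all contain \<open>u\<close>. As the clean edges stay connected, one of them joins
          \<open>u\<close> to an endpoint of an old clean edge.\<close>
        have bW0: "b \<notin> ?W" using na ab by (metis insert_commute)
        obtain z where z: "z \<in> \<Union>F" using \<open>?W \<noteq> {}\<close> by blast
        have "z \<in> \<Union>F'" using z move(5) by auto
        moreover have uF: "u \<in> \<Union>F'" "u \<notin> \<Union>F" using uvF' bW0 b_def by auto
        ultimately have "(z, u) \<in> (adj F')\<^sup>*"
          using move(7) unfolding connected_edge_subgraph_iff by blast
        then obtain x y where xy: "{x, y} \<in> F'" "x \<in> \<Union>F" "y \<notin> \<Union>F"
          using rtrancl_crossing[of z u "adj F'" "\<Union>F"] z uF(2) by auto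
        have xyF: "{x, y} \<notin> F" using xy by blast
        have xu: "x \<noteq> u" using xy(2) uF(2) by metis
        from xyF consider "{x, y} \<in> within G (set_mset P')" | "{x, y} = {v, u}"
          using xy move(5) m by auto
        then have "y = u"
        proof cases
          case 1
          show ?thesis
          proof (rule ccontr)
            assume "y \<noteq> u"
            then have "{x, y} \<in> within G (set_mset P)"
              using 1 xu P' by (auto simp: within_def dest: in_diffD)
            then show False using IH(4) xyF by blast
          qed
        next
          case 2
          then show ?thesis using xu by (auto simp: doubleton_eq_iff)
        qed
        moreover have xW: "\<phi> x \<in> ?W" using xy by blast
        moreover have "\<phi> x \<noteq> b" using xW bW0 by metis
        moreover have "{x, y} \<in> edges G" using xy(1) F's by blast
        ultimately have "{\<phi> x, b} \<in> edges H" using edge_down[of x y] b_def by simp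
        then show ?thesis using xW by blast
      qed
      ultimately show "(\<forall>y. {a, y} \<in> edges H \<longrightarrow> y = b) \<and> (\<exists>w\<in>?W. {w, b} \<in> edges H)" by blast
    qed
  qed
  then show ?case using move(4-6) by auto
qed

end

lemma is_contraction_of_imp_contraction:
  assumes "simple_graph H" "simple_graph G" "is_contraction_of H G"
  obtains \<phi> where "contraction H G \<phi>"
proof -
  obtain \<phi> where onto: "\<phi> ` verts G = verts H"
    and fc: "\<forall>v\<in>verts H. connected_graph (induced_subgraph G {x \<in> verts G. \<phi> x = v})"
    and ed: "\<forall>u\<in>verts H. \<forall>v\<in>verts H. u \<noteq> v \<longrightarrow> ({u, v} \<in> edges H \<longleftrightarrow>
         connected_graph (induced_subgraph G ({x \<in> verts G. \<phi> x = u} \<union> {x \<in> verts G. \<phi> x = v})))"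
    using assms(3) unfolding is_contraction_of_def by blast
  let ?f = "\<lambda>a. {x \<in> verts G. \<phi> x = a}"
  have fibre: "conn G (?f a)" if "a \<in> verts H" for a
    using fc that connected_induced_iff[OF assms(2), of "?f a"] by auto
  have edge: "{a, b} \<in> edges H \<longleftrightarrow> conn G (?f a \<union> ?f b)" if "a \<in> verts H" "b \<in> verts H" "a \<noteq> b" for a b
    using ed that connected_induced_iff[OF assms(2), of "?f a \<union> ?f b"] by auto
  have "contraction H G \<phi>"
  proof
    fix x y assume xy: "{x, y} \<in> edges G" "\<phi> x \<noteq> \<phi> y"
    have v: "x \<in> verts G" "y \<in> verts G"
      using simple_graph_edge_at[OF assms(2) xy(1)] by blast+
    then have "conn G (?f (\<phi> x) \<union> ?f (\<phi> y))"
      using onto by (intro conn_Un[OF fibre fibre _ _ xy(1)]) auto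
    then show "{\<phi> x, \<phi> y} \<in> edges H" using edge[of "\<phi> x" "\<phi> y"] v onto xy by blast
  next
    fix a b assume ab: "{a, b} \<in> edges H"
    then have v: "a \<in> verts H" "b \<in> verts H" "a \<noteq> b"
      using simple_graph_edge_at[OF assms(1) ab, of a] by (auto simp: doubleton_eq_iff)
    then have c: "conn G (?f a \<union> ?f b)" using edge ab by blast
    have "a \<in> \<phi> ` verts G" "b \<in> \<phi> ` verts G" using v onto by auto
    then obtain x y where "x \<in> ?f a" "y \<in> ?f b" by blast
    then obtain p q where "{p, q} \<in> edges G" "p \<in> ?f a" "q \<in> ?f a \<union> ?f b" "q \<notin> ?f a"
      using conn_crossing[OF c, of x "?f a" y] v by auto
    then show "\<exists>x y. {x, y} \<in> edges G \<and> \<phi> x = a \<and> \<phi> y = b" by blast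
  qed (use assms onto fibre in auto)
  then show ?thesis by (rule that)
qed

theorem mainTheorem4:
  fixes G1 :: "'b ugraph" and G2 :: "'a ugraph"
  assumes "simple_graph G1" and "simple_graph G2"
    and "connected_graph G1" and "connected_graph G2"
    and "is_contraction_of G1 G2"
  shows "cmms G1 \<le> cmms G2"
proof -
  obtain \<phi> where "contraction G1 G2 \<phi>"
    using is_contraction_of_imp_contraction[OF assms(1,2,5)] .
  then interpret contraction G1 G2 \<phi> .
  obtain P where P: "searched G2 (cmms G2) P (edges G2)"
    using connected_graph_searched_cmms[OF assms(2,4)] by blast
  let ?W = "\<phi> ` \<Union>(edges G2)"
  have "e \<subseteq> ?W" if e: "e \<in> edges G1" for e
  proof -
    obtain a b where ab: "e = {a, b}" using simple_graph_edgeE[OF assms(1) e] .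
    then obtain x y where "{x, y} \<in> edges G2" "\<phi> x = a" "\<phi> y = b" using edge_up e by blast
    then show ?thesis using ab by blast
  qed
  then have "within G1 ?W = edges G1" by (auto simp: within_def)
  then show ?thesis
    using swept_image[OF P] searched_imp_cmms_le[OF assms(1)] by (auto simp: swept_def)
qed

end
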